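(* Let $1\le t<s$ be integers, let $\Gamma$ be a finite alphabet of size $v$, and let $\phi:\Gamma^s\to\Gamma^s$ be a $(t,s,v)$-AONT whose array representation satisfies the combinatorial definition of a $(t,s,v)$-AONT. Suppose that all the input $s$-tuples are equally probable, i.e. $\Pr[\mathbf{X}=\mathbf{x}]=1/v^s$ for all $\mathbf{x}\in\Gamma^s$. Then the AONT is perfectly secure.
   Context: An $(N,k,v)$-array is an array with $N$ rows and $k$ columns whose entries lie in an alphabet $\Gamma$ of size $v$. If the columns are labeled by a set $C$ and $D\subseteq C$, then $A_D$ is the array obtained by deleting all columns not in $D$; $A$ is unbiased with respect to $D$ if the rows of $A_D$ contain every $|D|$-tuple of elements of $\Gamma$ exactly $N/v^{|D|}$ times. The array representation of $\phi:\Gamma^s\to\Gamma^s$ is the $(v^s,2s,v)$-array with columns labeled $1,\dots,2s$ having, for each $\mathbf{x}\in\Gamma^s$, one row consisting of $\mathbf{x}$ followed by $\phi(\mathbf{x})$. Combinatorial definition: a $(t,s,v)$-AONT (all-or-nothing transform) is a $(v^s,2s,v)$-array that is unbiased with respect to the column sets (1) $\{1,\dots,s\}$, (2) $\{s+1,\dots,2s\}$, and (3) $I\cup J$ for all $I\subseteq\{1,\dots,s\}$ with $|I|=t$ and all $J\subseteq\{s+1,\dots,2s\}$ with $|J|=s-t$. $\mathbf{X}=(\mathbf{X}_1,\dots,\mathbf{X}_s)$ is a random variable on $\Gamma^s$ denoting the input $s$-tuple, and $\mathbf{Y}=(\mathbf{Y}_1,\dots,\mathbf{Y}_s)=\phi(\mathbf{X})$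 is the output. For $I,J\subseteq\{1,\dots,s\}$, $\mathbf{X}_I=(\mathbf{X}_i)_{i\in I}$ and $\mathbf{Y}_J=(\mathbf{Y}_j)_{j\in J}$. With $\mathsf{H}$ denoting Shannon entropy, the AONT is perfectly secure (for the given distribution of $\mathbf{X}$) if $\mathsf{H}(\mathbf{X}_I\mid\mathbf{Y}_J)=\mathsf{H}(\mathbf{X}_I)$ for all $I,J\subseteq\{1,\dots,s\}$ with $|I|=t$, $|J|=s-t$; equivalently, $\Pr[\mathbf{X}_I=\mathbf{u},\mathbf{Y}_J=\mathbf{v}]=\Pr[\mathbf{X}_I=\mathbf{u}]\,\Pr[\mathbf{Y}_J=\mathbf{v}]$ for all such $I,J$ and all $\mathbf{u}\in\Gamma^t$, $\mathbf{v}\in\Gamma^{s-t}$. *)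

theory Defs
  imports "HOL-Probability.Probability"
begin

text \<open>
  An array is a family of rows indexed by a set \<open>R\<close>, so that repeated rows are counted with
  multiplicity; row \<open>r\<close> has the entry \<open>A r c\<close> in the column labeled \<open>c\<close>. Tuples indexed by a
  set \<open>D\<close> of labels are the extensional functions in \<open>D \<rightarrow>\<^sub>E \<Gamma>\<close>.
\<close>

definition is_array ::
    "nat \<Rightarrow> nat \<Rightarrow> nat \<Rightarrow> 'a set \<Rightarrow> 'r set \<Rightarrow> 'c set \<Rightarrow> ('r \<Rightarrow> 'c \<Rightarrow> 'a) \<Rightarrow> bool" where
  "is_array N k v \<Gamma> R C A \<longleftrightarrow>
     finite R \<and> card R = N \<and> finite C \<and> card C = k \<and> finite \<Gamma> \<and> card \<Gamma> = v \<and>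
     (\<forall>r\<in>R. \<forall>c\<in>C. A r c \<in> \<Gamma>)"

definition unbiased :: "'a set \<Rightarrow> 'r set \<Rightarrow> ('r \<Rightarrow> 'c \<Rightarrow> 'a) \<Rightarrow> 'c set \<Rightarrow> bool" where
  "unbiased \<Gamma> R A D \<longleftrightarrow>
     (\<forall>u \<in> D \<rightarrow>\<^sub>E \<Gamma>.
        real (card {r \<in> R. restrict (A r) D = u}) = real (card R) / real (card \<Gamma>) ^ card D)"

definition AONT_array ::
    "nat \<Rightarrow> nat \<Rightarrow> nat \<Rightarrow> 'a set \<Rightarrow> 'r set \<Rightarrow> ('r \<Rightarrow> nat \<Rightarrow> 'a) \<Rightarrow> bool" where
  "AONT_array t s v \<Gamma> R A \<longleftrightarrow>
     is_array (v ^ s) (2 * s) v \<Gamma> R {1..2 * s} A \<and>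
     unbiased \<Gamma> R A {1..s} \<and>
     unbiased \<Gamma> R A {s + 1..2 * s} \<and>
     (\<forall>I J. I \<subseteq> {1..s} \<and> card I = t \<and> J \<subseteq> {s + 1..2 * s} \<and> card J = s - t \<longrightarrow>
        unbiased \<Gamma> R A (I \<union> J))"

abbreviation tuples :: "'a set \<Rightarrow> nat \<Rightarrow> (nat \<Rightarrow> 'a) set" where
  "tuples \<Gamma> s \<equiv> {1..s} \<rightarrow>\<^sub>E \<Gamma>"

text \<open>The rows of the array representation of \<open>\<phi>\<close> are indexed by the input tuples \<open>x \<in> tuples \<Gamma> s\<close>.\<close>

definition array_rep ::
    "nat \<Rightarrow> ((nat \<Rightarrow> 'a) \<Rightarrow> (nat \<Rightarrow> 'a)) \<Rightarrow> (nat \<Rightarrow> 'a) \<Rightarrow> nat \<Rightarrow> 'a" where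
  "array_rep s \<phi> x c = (if c \<le> s then x c else \<phi> x (c - s))"

text \<open>
  The random variable \<open>X\<close> is the input \<open>s\<close>-tuple, \<open>\<phi> (X \<omega>)\<close> the output. Entropies are
  taken to the base \<open>b > 1\<close> of the locale; base 2 gives Shannon entropy in bits.
\<close>

definition (in information_space) perfectly_secure ::
    "nat \<Rightarrow> nat \<Rightarrow> ((nat \<Rightarrow> 'v) \<Rightarrow> (nat \<Rightarrow> 'v)) \<Rightarrow> ('a \<Rightarrow> nat \<Rightarrow> 'v) \<Rightarrow> bool" where
  "perfectly_secure t s \<phi> X \<longleftrightarrow>
     (\<forall>I J. I \<subseteq> {1..s} \<and> J \<subseteq> {1..s} \<and> card I = t \<and> card J = s - t \<longrightarrow>
        \<H>((\<lambda>\<omega>. restrict (X \<omega>) I) | (\<lambda>\<omega>. restrict (\<phi> (X \<omega>)) J)) =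
        \<H>(\<lambda>\<omega>. restrict (X \<omega>) I))"

end

theory Submission
  imports Defs
begin

text \<open>
  Perfect security says that \<open>X\<^sub>I\<close> and \<open>Y\<^sub>J\<close> are independent. When \<open>X\<close> is uniform, a uniformly
  random row of the array is drawn, and unbiasedness with respect to a column set \<open>D\<close> says exactly
  that the entries of this row in the columns of \<open>D\<close> form a uniformly distributed tuple in
  \<open>\<Gamma>\<^sup>D\<close> (lemma \<open>uniform_row_prob\<close>). Let \<open>J'\<close> be the set of columns that carry the outputs
  indexed by \<open>J\<close>. The array is unbiased with respect to \<open>I \<union> J'\<close> by assumption, and hence also
  with respect to \<open>I\<close> and to \<open>J'\<close>, because unbiasedness passes to subsets (lemma
  \<open>unbiased_subset\<close>). Since \<open>I\<close> and \<open>J'\<close> are disjoint, the joint probability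
  \<open>1 / v ^ (\<bar>I\<bar> + \<bar>J\<bar>)\<close> is the product of the marginal probabilities
  \<open>1 / v ^ \<bar>I\<bar>\<close> and \<open>1 / v ^ \<bar>J\<bar>\<close>. This factorization makes the mutual information of \<open>X\<^sub>I\<close> and
  \<open>Y\<^sub>J\<close> vanish, which is the entropy identity (lemma \<open>conditional_entropy_eq_entropy_if_indep\<close>).
\<close>

text \<open>
  The rows that show \<open>u\<close> on \<open>E\<close> are classified by what they show on \<open>D - E\<close>. There are
  \<open>card \<Gamma> ^ card (D - E)\<close> classes, and all of them have the same size since \<open>D\<close> is unbiased.
\<close>

lemma unbiased_subset:
  assumes unb: "unbiased \<Gamma> R A D" and "E \<subseteq> D" "finite D" "finite R" "finite \<Gamma>" "\<Gamma> \<noteq> {}"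
    and ent: "\<And>r c. r \<in> R \<Longrightarrow> c \<in> D \<Longrightarrow> A r c \<in> \<Gamma>"
  shows "unbiased \<Gamma> R A E"
  unfolding unbiased_def
proof
  fix u assume u: "u \<in> E \<rightarrow>\<^sub>E \<Gamma>"
  let ?W = "(D - E) \<rightarrow>\<^sub>E \<Gamma>"
  let ?join = "\<lambda>w. \<lambda>c\<in>D. if c \<in> E then u c else w c"
  let ?S = "\<lambda>w. {r \<in> R. restrict (A r) E = u \<and> restrict (A r) (D - E) = w}"
  have eq: "restrict (A r) D = ?join w \<longleftrightarrow> restrict (A r) E = u \<and> restrict (A r) (D - E) = w"
    if "w \<in> ?W" for r w
  proof -
    have "restrict (A r) D = ?join w \<longleftrightarrow> (\<forall>c\<in>E. A r c = u c) \<and> (\<forall>c\<in>D - E. A r c = w c)"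
      using \<open>E \<subseteq> D\<close> by (auto simp: fun_eq_iff restrict_def split: if_splits)
    moreover have "restrict (A r) E = u \<longleftrightarrow> (\<forall>c\<in>E. A r c = u c)"
      using PiE_arb[OF u] by (auto simp: fun_eq_iff restrict_def)
    moreover have "restrict (A r) (D - E) = w \<longleftrightarrow> (\<forall>c\<in>D - E. A r c = w c)"
      using PiE_arb[OF that] by (auto simp: fun_eq_iff restrict_def)
    ultimately show ?thesis by simp
  qed
  have Sc: "real (card (?S w)) = real (card R) / real (card \<Gamma>) ^ card D" if "w \<in> ?W" for w
  proof -
    have "?join w \<in> D \<rightarrow>\<^sub>E \<Gamma>"
      using u that by (auto simp: PiE_mem)
    then have "real (card {r \<in> R. restrict (A r) D = ?join w}) = real (card R) / real (card \<Gamma>) ^ card D"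
      using unb unfolding unbiased_def by blast
    then show ?thesis
      by (simp only: eq[OF that])
  qed
  have "{r \<in> R. restrict (A r) E = u} = (\<Union>w\<in>?W. ?S w)"
  proof -
    have "restrict (A r) (D - E) \<in> ?W" if "r \<in> R" for r
      using ent[OF that] by auto
    then show ?thesis
      by blast
  qed
  moreover have "finite ?W"
    using \<open>finite D\<close> \<open>finite \<Gamma>\<close> by (simp add: finite_PiE)
  moreover have "\<forall>w\<in>?W. \<forall>w'\<in>?W. w \<noteq> w' \<longrightarrow> ?S w \<inter> ?S w' = {}"
    by blast
  ultimately have "card {r \<in> R. restrict (A r) E = u} = (\<Sum>w\<in>?W. card (?S w))"
    using \<open>finite R\<close> by (simp add: card_UN_disjoint)
  then have count: "real (card {r \<in> R. restrict (A r) E = u})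
      = real (card \<Gamma>) ^ card (D - E) * (real (card R) / real (card \<Gamma>) ^ card D)"
    using \<open>finite D\<close> Sc by (simp add: card_PiE)
  have "card D = card (D - E) + card E"
    using \<open>finite D\<close> \<open>E \<subseteq> D\<close> by (metis card_Diff_subset card_mono finite_subset le_add_diff_inverse2)
  then show "real (card {r \<in> R. restrict (A r) E = u}) = real (card R) / real (card \<Gamma>) ^ card E"
    using count \<open>finite \<Gamma>\<close> \<open>\<Gamma> \<noteq> {}\<close> by (simp add: power_add)
qed

lemma (in prob_space) prob_uniform_on:
  assumes "finite R" and X: "X \<in> measurable M (count_space R)"
    and unif: "\<And>x. x \<in> R \<Longrightarrow> prob {\<omega> \<in> space M. X \<omega> = x} = p"
  shows "prob {\<omega> \<in> space M. P (X \<omega>)} = real (card {x \<in> R. P x}) * p"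
proof -
  have XR: "X \<omega> \<in> R" if "\<omega> \<in> space M" for \<omega>
    using measurable_space[OF X that] by simp
  have ev: "{\<omega> \<in> space M. X \<omega> = x} \<in> events" if "x \<in> R" for x
    using measurable_sets[OF X, of "{x}"] that by (simp add: vimage_def Int_def conj_commute)
  have "{\<omega> \<in> space M. P (X \<omega>)} = (\<Union>x\<in>{x \<in> R. P x}. {\<omega> \<in> space M. X \<omega> = x})"
    using XR by auto
  then have "prob {\<omega> \<in> space M. P (X \<omega>)}
      = (\<Sum>x\<in>{x \<in> R. P x}. prob {\<omega> \<in> space M. X \<omega> = x})"
    using \<open>finite R\<close> ev
    by (simp only:) (rule finite_measure_finite_Union, auto simp: disjoint_family_on_def)
  then show ?thesis
    using unif by simp
qed

lemma (in prob_space) uniform_row_prob: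
  assumes "finite R" "R \<noteq> {}" and X: "X \<in> measurable M (count_space R)"
    and unif: "\<And>r. r \<in> R \<Longrightarrow> prob {\<omega> \<in> space M. X \<omega> = r} = 1 / real (card R)"
    and "unbiased \<Gamma> R A D" "u \<in> D \<rightarrow>\<^sub>E \<Gamma>"
  shows "prob {\<omega> \<in> space M. restrict (A (X \<omega>)) D = u} = 1 / real (card \<Gamma>) ^ card D"
  using prob_uniform_on[OF \<open>finite R\<close> X unif, of "\<lambda>r. restrict (A r) D = u"] assms
  by (simp add: unbiased_def card_gt_0_iff)

text \<open>
  Disjointness makes a pair of tuples on \<open>D\<close> and \<open>E\<close> the same as one tuple on \<open>D \<union> E\<close>, so the
  joint distribution is uniform and its exponent \<open>card (D \<union> E)\<close> splits additively.
\<close>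

lemma (in prob_space) uniform_row_prob_disjoint:
  assumes "finite R" "R \<noteq> {}" and X: "X \<in> measurable M (count_space R)"
    and unif: "\<And>r. r \<in> R \<Longrightarrow> prob {\<omega> \<in> space M. X \<omega> = r} = 1 / real (card R)"
    and "finite \<Gamma>" "\<Gamma> \<noteq> {}"
    and ent: "\<And>r c. r \<in> R \<Longrightarrow> c \<in> D \<union> E \<Longrightarrow> A r c \<in> \<Gamma>"
    and unb: "unbiased \<Gamma> R A (D \<union> E)" and "D \<inter> E = {}" "finite D" "finite E"
    and u: "u \<in> D \<rightarrow>\<^sub>E \<Gamma>" and w: "w \<in> E \<rightarrow>\<^sub>E \<Gamma>"
  shows "prob {\<omega> \<in> space M. restrict (A (X \<omega>)) D = u \<and> restrict (A (X \<omega>)) E = w}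
    = prob {\<omega> \<in> space M. restrict (A (X \<omega>)) D = u} * prob {\<omega> \<in> space M. restrict (A (X \<omega>)) E = w}"
proof -
  note row = uniform_row_prob[OF \<open>finite R\<close> \<open>R \<noteq> {}\<close> X unif]
  have sub: "unbiased \<Gamma> R A F" if "F \<subseteq> D \<union> E" for F
    by (rule unbiased_subset[OF unb that]) (use assms in auto)
  let ?j = "\<lambda>c\<in>D \<union> E. if c \<in> D then u c else w c"
  have "restrict a (D \<union> E) = ?j \<longleftrightarrow> restrict a D = u \<and> restrict a E = w" for a
  proof -
    have "restrict a (D \<union> E) = ?j \<longleftrightarrow> (\<forall>c\<in>D. a c = u c) \<and> (\<forall>c\<in>E. a c = w c)"
      using \<open>D \<inter> E = {}\<close> by (auto simp: fun_eq_iff restrict_def split: if_splits)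
    moreover have "restrict a D = u \<longleftrightarrow> (\<forall>c\<in>D. a c = u c)"
      using PiE_arb[OF u] by (auto simp: fun_eq_iff restrict_def)
    moreover have "restrict a E = w \<longleftrightarrow> (\<forall>c\<in>E. a c = w c)"
      using PiE_arb[OF w] by (auto simp: fun_eq_iff restrict_def)
    ultimately show ?thesis by simp
  qed
  moreover have "?j \<in> D \<union> E \<rightarrow>\<^sub>E \<Gamma>"
    using u w by (auto simp: PiE_mem)
  ultimately have "prob {\<omega> \<in> space M. restrict (A (X \<omega>)) D = u \<and> restrict (A (X \<omega>)) E = w}
      = 1 / real (card \<Gamma>) ^ card (D \<union> E)"
    using row[OF _ unb, of ?j] by simp
  then show ?thesis
    using row[OF _ sub u] row[OF _ sub w] assms by (simp add: card_Un_disjoint power_add)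
qed

text \<open>
  The difference \<open>\<H>(X) - \<H>(X | Y)\<close> is the mutual information \<open>\<I>(X ; Y)\<close>, the average
  of \<open>log b\<close> of the joint probability divided by the product of the marginals. Under \<open>indep\<close>
  this quotient is \<open>1\<close> at every pair of positive probability.
\<close>

lemma (in information_space) conditional_entropy_eq_entropy_if_indep:
  assumes X: "simple_function M X" and Y: "simple_function M Y"
    and indep: "\<And>x y. x \<in> X ` space M \<Longrightarrow> y \<in> Y ` space M \<Longrightarrow>
      prob {\<omega> \<in> space M. X \<omega> = x \<and> Y \<omega> = y}
        = prob {\<omega> \<in> space M. X \<omega> = x} * prob {\<omega> \<in> space M. Y \<omega> = y}"
  shows "\<H>(X | Y) = \<H>(X)"
proof -
  have "\<I>(X ; Y) = 0"
  proof (rule mutual_information_eq_0_simple)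
    show "simple_distributed M X (\<lambda>x. prob {\<omega> \<in> space M. X \<omega> = x})"
      by (rule simple_distributedI[OF X]) (auto intro!: arg_cong[where f=prob])
    show "simple_distributed M Y (\<lambda>y. prob {\<omega> \<in> space M. Y \<omega> = y})"
      by (rule simple_distributedI[OF Y]) (auto intro!: arg_cong[where f=prob])
    show "simple_distributed M (\<lambda>\<omega>. (X \<omega>, Y \<omega>))
        (\<lambda>z. prob {\<omega> \<in> space M. X \<omega> = fst z \<and> Y \<omega> = snd z})"
      by (rule simple_distributedI[OF simple_function_Pair[OF X Y]])
        (auto intro!: arg_cong[where f=prob])
  qed (use indep in auto)
  then show ?thesis
    using mutual_information_eq_entropy_conditional_entropy[OF X Y] by simp
qed

theorem theorem2p3:
  fixes t s v :: nat
    and \<Gamma> :: "'v set"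
    and \<phi> :: "(nat \<Rightarrow> 'v) \<Rightarrow> (nat \<Rightarrow> 'v)"
    and M :: "'w measure"
    and b :: real
    and X :: "'w \<Rightarrow> (nat \<Rightarrow> 'v)"
  assumes "1 \<le> t" and "t < s"
    and "finite \<Gamma>" and "card \<Gamma> = v"
    and "\<phi> \<in> tuples \<Gamma> s \<rightarrow> tuples \<Gamma> s"
    and "AONT_array t s v \<Gamma> (tuples \<Gamma> s) (array_rep s \<phi>)"
    and "information_space M b"
    and "X \<in> measurable M (count_space (tuples \<Gamma> s))"
    and "\<forall>x \<in> tuples \<Gamma> s. measure M {\<omega> \<in> space M. X \<omega> = x} = 1 / real v ^ s"
  shows "information_space.perfectly_secure M b t s \<phi> X"
proof -
  interpret information_space M b by fact
  let ?R = "tuples \<Gamma> s" and ?A = "array_rep s \<phi>"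
  note X = \<open>X \<in> measurable M (count_space ?R)\<close>
  have XR: "X \<omega> \<in> ?R" if "\<omega> \<in> space M" for \<omega>
    using measurable_space[OF X that] by simp
  have "?R \<noteq> {}"
    using XR not_empty by blast
  moreover have "finite ?R"
    using \<open>finite \<Gamma>\<close> by (auto intro: finite_PiE)
  moreover have "card ?R = v ^ s"
    using \<open>card \<Gamma> = v\<close> by (simp add: card_PiE)
  moreover have "\<Gamma> \<noteq> {}"
    using \<open>?R \<noteq> {}\<close> \<open>t < s\<close> by (auto simp: PiE_eq_empty_iff)
  ultimately have R: "?R \<noteq> {}" "finite ?R" "card ?R = v ^ s" "\<Gamma> \<noteq> {}"
    by auto
  have ent: "?A r c \<in> \<Gamma>" if "r \<in> ?R" "c \<in> {1..2 * s}" for r c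
    using \<open>AONT_array t s v \<Gamma> ?R ?A\<close> that unfolding AONT_array_def is_array_def by blast
  have restrict_tuple: "restrict x K \<in> K \<rightarrow>\<^sub>E \<Gamma>" if "K \<subseteq> {1..s}" "x \<in> ?R" for K x
    using that by (meson PiE_mem restrict_PiE_iff subsetD)
  have simple: "simple_function M (\<lambda>\<omega>. f (X \<omega>))" for f :: "(nat \<Rightarrow> 'v) \<Rightarrow> nat \<Rightarrow> 'v"
  proof -
    have "simple_function M X"
      unfolding simple_function_def
    proof
      have "X ` space M \<subseteq> ?R"
        using XR by blast
      then show "finite (X ` space M)"
        using R(2) finite_subset by blast
      show "\<forall>x\<in>X ` space M. X -` {x} \<inter> space M \<in> events"
        using XR by (auto intro!: measurable_sets[OF X])
    qed
    from simple_function_compose[OF this, of f] show ?thesis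
      by (simp add: comp_def)
  qed
  show ?thesis
    unfolding perfectly_secure_def
  proof (intro allI impI, elim conjE)
    fix I J assume I: "I \<subseteq> {1..s}" and J: "J \<subseteq> {1..s}" and "card I = t" "card J = s - t"
    \<comment> \<open>Output \<open>j\<close> is stored in column \<open>j + s\<close> of the array.\<close>
    let ?J' = "(\<lambda>j. j + s) ` J"
    have fin: "finite I" "finite J"
      using I J by (auto intro: finite_subset)
    have J'_sub: "?J' \<subseteq> {s + 1..2 * s}"
      using J by auto
    with I have "I \<inter> ?J' = {}"
      by fastforce
    moreover have "card ?J' = s - t"
      using \<open>card J = s - t\<close> by (simp add: card_image inj_on_def)
    ultimately have J': "?J' \<subseteq> {s + 1..2 * s}" "card ?J' = s - t" "I \<inter> ?J' = {}" "finite ?J'"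
      using J'_sub fin by auto
    have unb: "unbiased \<Gamma> ?R ?A (I \<union> ?J')"
      using \<open>AONT_array t s v \<Gamma> ?R ?A\<close> I \<open>card I = t\<close> J' unfolding AONT_array_def by blast
    have XI: "restrict (?A x) I = restrict x I" for x
      using I by (auto simp: array_rep_def restrict_def fun_eq_iff)
    have YJ: "restrict (\<phi> x) J = y \<longleftrightarrow> restrict (?A x) ?J' = (\<lambda>c\<in>?J'. y (c - s))"
      if "y \<in> J \<rightarrow>\<^sub>E \<Gamma>" for x y
    proof -
      have "restrict (\<phi> x) J = y \<longleftrightarrow> (\<forall>j\<in>J. \<phi> x j = y j)"
        using PiE_arb[OF that] by (auto simp: fun_eq_iff restrict_def)
      moreover have "restrict (?A x) ?J' = (\<lambda>c\<in>?J'. y (c - s)) \<longleftrightarrow> (\<forall>j\<in>J. ?A x (j + s) = y j)"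
        by (auto simp: fun_eq_iff restrict_def)
      moreover have "?A x (j + s) = \<phi> x j" if "j \<in> J" for j
        using J that by (auto simp: array_rep_def)
      ultimately show ?thesis by simp
    qed
    show "\<H>((\<lambda>\<omega>. restrict (X \<omega>) I) | (\<lambda>\<omega>. restrict (\<phi> (X \<omega>)) J)) = \<H>(\<lambda>\<omega>. restrict (X \<omega>) I)"
    proof (rule conditional_entropy_eq_entropy_if_indep)
      show "simple_function M (\<lambda>\<omega>. restrict (X \<omega>) I)"
        by (rule simple)
      show "simple_function M (\<lambda>\<omega>. restrict (\<phi> (X \<omega>)) J)"
        by (rule simple)
      fix x y
      assume "x \<in> (\<lambda>\<omega>. restrict (X \<omega>) I) ` space M" "y \<in> (\<lambda>\<omega>. restrict (\<phi> (X \<omega>)) J) ` space M"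
      then obtain \<omega> \<omega>' where "\<omega> \<in> space M" "x = restrict (X \<omega>) I"
          and "\<omega>' \<in> space M" "y = restrict (\<phi> (X \<omega>')) J"
        by blast
      then have x: "x \<in> I \<rightarrow>\<^sub>E \<Gamma>" and y: "y \<in> J \<rightarrow>\<^sub>E \<Gamma>"
        using restrict_tuple[OF I XR] restrict_tuple[OF J funcset_mem[OF \<open>\<phi> \<in> ?R \<rightarrow> ?R\<close> XR]]
        by simp_all
      let ?y = "\<lambda>c\<in>?J'. y (c - s)"
      have y': "?y \<in> ?J' \<rightarrow>\<^sub>E \<Gamma>"
        using y by auto
      have "prob {\<omega> \<in> space M. restrict (?A (X \<omega>)) I = x \<and> restrict (?A (X \<omega>)) ?J' = ?y}
          = prob {\<omega> \<in> space M. restrict (?A (X \<omega>)) I = x} * prob {\<omega> \<in> space M. restrict (?A (X \<omega>)) ?J' = ?y}"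
      proof (rule uniform_row_prob_disjoint[OF R(2,1) X _ _ R(4) _ unb J'(3) fin(1) J'(4) x y'])
        have "I \<union> ?J' \<subseteq> {1..2 * s}"
          using I J'_sub by fastforce
        then show "?A r c \<in> \<Gamma>" if "r \<in> ?R" "c \<in> I \<union> ?J'" for r c
          using ent that by blast
      qed (use R assms(3,4,9) in simp_all)
      then show "prob {\<omega> \<in> space M. restrict (X \<omega>) I = x \<and> restrict (\<phi> (X \<omega>)) J = y}
          = prob {\<omega> \<in> space M. restrict (X \<omega>) I = x} * prob {\<omega> \<in> space M. restrict (\<phi> (X \<omega>)) J = y}"
        by (simp only: YJ[OF y] XI)
    qed
  qed
qed

end
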